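(* Let $\Pi$ be a Gibbs partition with parameters $(\alpha,V)$, let $n,m\ge1$, and condition on the restriction of $\Pi$ to $[n]$ being a given partition into $j$ blocks with sizes $(n_1,\dots,n_j)$. Let $K_m$ be the number of new blocks generated by the integers $n+1,\dots,n+m$, let $M_{i,m}$ ($i=1,\dots,j$) be the number of these integers falling in the $i$-th old block, and for $l\in\{1,\dots,n+m\}$ let $O^{(n)}_{l,m}=\sum_{i=1}^j1\{n_i+M_{i,m}=l\}$. For $\xi\ge1$ let $m_\xi=\#\{i\in\{1,\dots,j\}:n_i=\xi\}$. Then the Bayesian nonparametric estimator under quadratic loss of the (random) probability $$P^{n+m+1}_{old,l}(\alpha,V)=\frac{V_{n+m+1,j+K_m}}{V_{n+m,j+K_m}}(l-\alpha)O^{(n)}_{l,m}$$ that observation $n+m+1$ belongs to an old species represented $l$ times is $$\mathbb{E}\left(\frac{V_{n+m+1,j+K_m}}{V_{n+m,j+K_m}}(l-\alpha)O^{(n)}_{l,m}\right)=(l-\alpha)\sum_{\xi=1}^{l}m_\xi\binom m{l-\xi}(\xi-\alpha)_{l-\xi}\sum_{k=0}^{m-l+\xi}\frac{V_{n+m+1,j+k}}{V_{n,j}}\,S^{-1,-\alpha,-(n-j\alpha-\xi+\alpha)}_{m-l+\xi,\,k},$$ where the expectation is with respect to the conditional law of $(M_{1,m},\dots,M_{j,m},K_m)$ given the partition of $[n]$.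
   Context: Notation: $(x)_n=x(x+1)\cdots(x+n-1)$ ($(x)_0=1$). Terms with $\binom{m}{l-\xi}=0$ (i.e. $l-\xi>m$) are zero. The Bayesian estimator under quadratic loss is the conditional expectation given the observed partition of $[n]$ (blocks are "species"). Gibbs partition with parameters $(\alpha,V)$: $\alpha\in(-\infty,1)$ and $V=(V_{n,k})_{1\le k\le n}$ are nonnegative weights with $V_{1,1}=1$ and $V_{n,k}=(n-k\alpha)V_{n+1,k}+V_{n+1,k+1}$; $\Pi$ is the exchangeable random partition of the positive integers such that for every $n$ and every partition $\{A_1,\dots,A_k\}$ of $[n]=\{1,\dots,n\}$, the restriction $\Pi_n$ of $\Pi$ to $[n]$ satisfies $\mathbb{P}(\Pi_n=\{A_1,\dots,A_k\})=V_{n,k}\prod_{i=1}^k(1-\alpha)_{|A_i|-1}$. Conditional setting: it is assumed $V_{n,j}>0$. Given $\Pi_n$ (with $j$ blocks of sizes $n_1,\dots,n_j$), a block of $\Pi_{n+m}$ is old if it meets $[n]$, new otherwise; the $i$-th old block is the one containing the $i$-th block of $\Pi_n$. The conditional probability that $\Pi_{n+m}$ equals a specified partition extending $\Pi_n$, in which the old blocks gain $m_1,\dots,m_j\ge0$ elements and there are $k$ new blocks of sizes $s_1,\dots,s_k\ge1$, is $\frac{V_{n+m,j+k}}{V_{n,j}}\prod_{i=1}^j(n_i-\alpha)_{m_i}\prod_{i=1}^k(1-\alpha)_{s_i-1}$. (In particular $V_{n+m,j+K_m}>0$ almost surely.) Generalized central Stirling numbers: $S^{-1,-\alpha}_{n,k}=\frac{n!}{k!}\sum_{(n_1,\dots,n_k)}\prod_{j=1}^k\frac{(1-\alpha)_{n_j-1}}{n_j!}$,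 the sum being over compositions of $n$ into $k$ positive parts ($S_{0,0}^{-1,-\alpha}=1$, $S_{n,0}^{-1,-\alpha}=0$ for $n\ge1$, $S_{n,k}^{-1,-\alpha}=0$ for $k>n$). Generalized non-central Stirling numbers: $S^{-1,-\alpha,\gamma}_{n,k}=\sum_{s=k}^n\binom ns S^{-1,-\alpha}_{s,k}(-\gamma)_{n-s}$. *)

theory Defs
  imports "HOL-Probability.Probability"
begin

text \<open>
  Partitions are sets of blocks (see \<^const>\<open>partition_on\<close>), and the rising factorial $(x)_n$ is
  \<^const>\<open>pochhammer\<close>.
\<close>

section \<open>Generalized Stirling numbers\<close>

definition compositions :: "nat \<Rightarrow> nat \<Rightarrow> nat list set" where
  "compositions n k = {ns. length ns = k \<and> sum_list ns = n \<and> (\<forall>p\<in>set ns. 1 \<le> p)}"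

text \<open>
  \<open>gstirling \<alpha> n k\<close> is $S^{-1,-\alpha}_{n,k}$. The boundary values ($1$ at $(0,0)$, and $0$ at
  $(n,0)$ with $n \ge 1$ and whenever $k > n$) need no separate clauses: the only composition into
  $0$ parts is the empty list, and there is none with more parts than $n$.
\<close>

definition gstirling :: "real \<Rightarrow> nat \<Rightarrow> nat \<Rightarrow> real" where
  "gstirling \<alpha> n k = fact n / fact k *
     (\<Sum>ns\<in>compositions n k. \<Prod>p\<leftarrow>ns. pochhammer (1 - \<alpha>) (p - 1) / fact p)"

text \<open>\<open>gstirling_nc \<alpha> \<gamma> n k\<close> is $S^{-1,-\alpha,\gamma}_{n,k}$.\<close>

definition gstirling_nc :: "real \<Rightarrow> real \<Rightarrow> nat \<Rightarrow> nat \<Rightarrow> real" where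
  "gstirling_nc \<alpha> \<gamma> n k =
     (\<Sum>s=k..n. real (n choose s) * gstirling \<alpha> s k * pochhammer (- \<gamma>) (n - s))"

section \<open>Gibbs partitions\<close>

definition gibbs_weights :: "real \<Rightarrow> (nat \<Rightarrow> nat \<Rightarrow> real) \<Rightarrow> bool" where
  "gibbs_weights \<alpha> V \<longleftrightarrow> V 1 1 = 1 \<and>
     (\<forall>n k. 1 \<le> k \<and> k \<le> n \<longrightarrow>
        0 \<le> V n k \<and> V n k = (real n - real k * \<alpha>) * V (n + 1) k + V (n + 1) (k + 1))"

definition restrict_partition :: "nat \<Rightarrow> nat set set \<Rightarrow> nat set set" where
  "restrict_partition n P = (\<lambda>B. B \<inter> {1..n}) ` P - {{}}"

text \<open>
  A random partition of the positive integers is measurable with respect to the sigma-algebra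
  generated by the restrictions to the sets \<open>{1..n}\<close>. The prescribed probabilities depend on a
  partition only through its block sizes, so exchangeability is part of the last clause.
\<close>

definition gibbs_partition ::
    "'a measure \<Rightarrow> real \<Rightarrow> (nat \<Rightarrow> nat \<Rightarrow> real) \<Rightarrow> ('a \<Rightarrow> nat set set) \<Rightarrow> bool" where
  "gibbs_partition M \<alpha> V \<rho> \<longleftrightarrow>
     prob_space M \<and> \<alpha> < 1 \<and> gibbs_weights \<alpha> V \<and>
     (\<forall>\<omega>\<in>space M. partition_on {1..} (\<rho> \<omega>)) \<and>
     (\<forall>n P. {\<omega> \<in> space M. restrict_partition n (\<rho> \<omega>) = P} \<in> sets M) \<and>
     (\<forall>n\<ge>1. \<forall>P. partition_on {1..n} P \<longrightarrow>
        measure M {\<omega> \<in> space M. restrict_partition n (\<rho> \<omega>) = P} =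
          V n (card P) * (\<Prod>B\<in>P. pochhammer (1 - \<alpha>) (card B - 1)))"

section \<open>Old and new blocks\<close>

text \<open>
  In this section \<open>P\<close> is a partition of the positive integers, and \<open>A 1, \<dots>, A j\<close> are the blocks
  of its restriction to \<open>{1..n}\<close> in some order; the \<open>i\<close>-th old block is the one containing \<open>A i\<close>.
\<close>

definition new_blocks :: "nat \<Rightarrow> nat \<Rightarrow> nat set set \<Rightarrow> nat" where
  "new_blocks n m P = card {B \<in> restrict_partition (n + m) P. B \<inter> {1..n} = {}}"

definition old_block_gain :: "nat \<Rightarrow> nat \<Rightarrow> (nat \<Rightarrow> nat set) \<Rightarrow> nat \<Rightarrow> nat set set \<Rightarrow> nat" where
  "old_block_gain n m A i P = card {x \<in> {n + 1..n + m}. \<exists>B\<in>P. A i \<subseteq> B \<and> x \<in> B}"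

definition old_blocks_of_size ::
    "nat \<Rightarrow> nat \<Rightarrow> (nat \<Rightarrow> nat set) \<Rightarrow> nat \<Rightarrow> nat \<Rightarrow> nat set set \<Rightarrow> nat" where
  "old_blocks_of_size n m A j l P =
     (\<Sum>i=1..j. of_bool (card (A i) + old_block_gain n m A i P = l))"

definition blocks_of_size :: "(nat \<Rightarrow> nat set) \<Rightarrow> nat \<Rightarrow> nat \<Rightarrow> nat" where
  "blocks_of_size A j \<xi> = card {i \<in> {1..j}. card (A i) = \<xi>}"

definition P_old ::
    "real \<Rightarrow> (nat \<Rightarrow> nat \<Rightarrow> real) \<Rightarrow> nat \<Rightarrow> nat \<Rightarrow> (nat \<Rightarrow> nat set) \<Rightarrow> nat \<Rightarrow> nat \<Rightarrow> nat set set \<Rightarrow> real"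
  where
  "P_old \<alpha> V n m A j l P =
     V (n + m + 1) (j + new_blocks n m P) / V (n + m) (j + new_blocks n m P) *
     (real l - \<alpha>) * real (old_blocks_of_size n m A j l P)"

text \<open>
  The event that the integer \<open>n + m + 1\<close> joins a block that meets \<open>{1..n}\<close> and has exactly \<open>l\<close>
  elements in \<open>{1..n + m}\<close>.
\<close>

definition joins_old_of_size :: "nat \<Rightarrow> nat \<Rightarrow> nat \<Rightarrow> nat set set \<Rightarrow> bool" where
  "joins_old_of_size n m l P \<longleftrightarrow>
     (\<exists>B\<in>P. n + m + 1 \<in> B \<and> B \<inter> {1..n} \<noteq> {} \<and> card (B \<inter> {1..n + m}) = l)"

section \<open>Conditioning on the observed partition\<close>

definition given_partition ::
    "'a measure \<Rightarrow> ('a \<Rightarrow> nat set set) \<Rightarrow> nat \<Rightarrow> nat set set \<Rightarrow> 'a measure" where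
  "given_partition M \<rho> n P =
     uniform_measure M {\<omega> \<in> space M. restrict_partition n (\<rho> \<omega>) = P}"

text \<open>
  Under quadratic loss the Bayesian estimator of a random quantity \<open>X\<close> is its conditional
  expectation given the observed partition, here given an observation of positive probability.
\<close>

definition bayes_estimator ::
    "'a measure \<Rightarrow> ('a \<Rightarrow> nat set set) \<Rightarrow> nat \<Rightarrow> nat set set \<Rightarrow> ('a \<Rightarrow> real) \<Rightarrow> real" where
  "bayes_estimator M \<rho> n P X = (\<integral>\<omega>. X \<omega> \<partial>given_partition M \<rho> n P)"

end

theory Submission
  imports Defs "HOL-Computational_Algebra.Formal_Power_Series"
begin

text \<open>
  Passing from \<open>{1..N}\<close> to \<open>{1..N + 1}\<close>, the integer \<open>N + 1\<close> either opens a new block or joins an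
  existing block \<open>B\<close>, which multiplies the weight $\prod_B (1-\alpha)_{|B|-1}$ by $|B| - \alpha$. Hence
  the total weight of the extensions of the observed partition in which a given old block of size
  $\xi$ gains $r$ elements and $k$ new blocks appear satisfies a recurrence in $m$, whose solution is
  $\binom{m}{r} (\xi-\alpha)_r S^{-1,-\alpha,\gamma}_{m-r,k}$ with $\gamma = -(n - j\alpha - \xi + \alpha)$.
  In the expectation the factor $V_{n+m,j+K_m}$ of the conditional law cancels against the
  denominator of $P^{n+m+1}_{old,l}$, and a sum over old blocks and over $k$ remains.
\<close>

section \<open>Recurrences for generalized Stirling numbers\<close>

text \<open>The pair (r, k) suffices as state for the induction because the weight |B| - \<alpha> of
  joining a block is linear in its size: summed over all blocks except the chosen one, it depends
  only on the number of integers so far, the size of the chosen block and the number of blocks.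
  Hence the sizes of the remaining old blocks and of the new blocks are never enumerated. On sums
  over compositions the matching recurrence in n is not visible. It comes from a differential
  equation for their exponential generating function. The conditional law is derived from the Gibbs
  probabilities of the restrictions to {1..n} and to {1..n + m}, as a quotient. That
  \<open>P_old\<close> is the conditional probability of joining an old block of size l is the same
  kind of computation with a single added integer.\<close>

lemma finite_compositions: "finite (compositions n k)"
proof (rule finite_subset)
  show "compositions n k \<subseteq> {ns. set ns \<subseteq> {..n} \<and> length ns = k}"
    by (auto simp: compositions_def member_le_sum_list)
qed (simp add: finite_lists_length_eq)

lemma compositions_Suc:
  "compositions n (Suc k) = (\<Union>p\<in>{1..n}. (#) p ` compositions (n - p) k)"
proof (intro equalityI subsetI)
  fix ns assume "ns \<in> compositions n (Suc k)"
  then obtain p qs where "ns = p # qs" "length qs = k" "p + sum_list qs = n" "1 \<le> p"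
      "\<forall>q\<in>set qs. 1 \<le> q"
    by (cases ns) (auto simp: compositions_def)
  then show "ns \<in> (\<Union>p\<in>{1..n}. (#) p ` compositions (n - p) k)"
    by (auto simp: compositions_def intro!: bexI[of _ p])
qed (auto simp: compositions_def)

text \<open>This series is (1 - (1 - t)^\<alpha>) / \<alpha>, and -log(1 - t) for \<alpha> = 0.
  Giving it by coefficients avoids real powers and a case distinction at \<alpha> = 0.\<close>

definition gstirling_fps :: "real \<Rightarrow> real fps" where
  "gstirling_fps \<alpha> = Abs_fps (\<lambda>p. if p = 0 then 0 else pochhammer (1 - \<alpha>) (p - 1) / fact p)"

text \<open>Multiplying by one more factor chooses the first part of the composition, so the sum
  over compositions becomes a coefficient of a power, to which the derivative can be
  applied.\<close>

lemma gstirling_fps_power_nth: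
  "fps_nth (gstirling_fps \<alpha> ^ k) n =
     (\<Sum>ns\<in>compositions n k. \<Prod>p\<leftarrow>ns. pochhammer (1 - \<alpha>) (p - 1) / fact p)"
proof (induction k arbitrary: n)
  case 0
  have "compositions n 0 = (if n = 0 then {[]} else {})"
    by (auto simp: compositions_def)
  then show ?case by simp
next
  case (Suc k)
  let ?w = "\<lambda>p. pochhammer (1 - \<alpha>) (p - 1) / fact p :: real"
  have "fps_nth (gstirling_fps \<alpha> ^ Suc k) n =
      (\<Sum>p=0..n. fps_nth (gstirling_fps \<alpha>) p * fps_nth (gstirling_fps \<alpha> ^ k) (n - p))"
    by (simp add: fps_mult_nth)
  \<comment> \<open>The constant term of the series is 0, which matches the condition that parts are
    positive.\<close>
  also have "\<dots> = (\<Sum>p\<in>{1..n}. ?w p * fps_nth (gstirling_fps \<alpha> ^ k) (n - p))"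
    by (rule sum.mono_neutral_cong_right) (auto simp: gstirling_fps_def)
  also have "\<dots> = (\<Sum>p\<in>{1..n}. \<Sum>ns\<in>(#) p ` compositions (n - p) k. prod_list (map ?w ns))"
    by (simp add: Suc.IH sum_distrib_left sum.reindex)
  also have "\<dots> = (\<Sum>ns\<in>compositions n (Suc k). prod_list (map ?w ns))"
    unfolding compositions_Suc
    by (rule sum.UNION_disjoint[symmetric]) (auto simp: finite_compositions)
  finally show ?case .
qed

text \<open>In closed form both sides are (1 - t)^\<alpha>. On coefficients the identity is one step
  of the rising factorial: the factor 1 - \<alpha> + p splits into p + 1, which cancels against the
  factorial, and -\<alpha>.\<close>

lemma gstirling_fps_deriv:
  "(1 - fps_X) * fps_deriv (gstirling_fps \<alpha>) = 1 - fps_const \<alpha> * gstirling_fps \<alpha>"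
proof (rule fps_ext)
  fix n
  have deriv: "fps_nth (fps_deriv (gstirling_fps \<alpha>)) p = pochhammer (1 - \<alpha>) p / fact p" for p
    by (simp add: gstirling_fps_def del: of_nat_Suc)
  show "fps_nth ((1 - fps_X) * fps_deriv (gstirling_fps \<alpha>)) n =
      fps_nth (1 - fps_const \<alpha> * gstirling_fps \<alpha>) n"
  proof (cases n)
    case 0
    then show ?thesis
      by (simp add: left_diff_distrib gstirling_fps_def)
  next
    case (Suc p)
    have "pochhammer (1 - \<alpha>) p / fact p = real (Suc p) * (pochhammer (1 - \<alpha>) p / fact (Suc p))"
      by (simp del: of_nat_Suc)
    moreover have "pochhammer (1 - \<alpha>) (Suc p) / fact (Suc p) =
        (1 - \<alpha> + real p) * (pochhammer (1 - \<alpha>) p / fact (Suc p))"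
      by (simp add: pochhammer_Suc del: fact_Suc)
    ultimately have "pochhammer (1 - \<alpha>) (Suc p) / fact (Suc p) =
        pochhammer (1 - \<alpha>) p / fact p - \<alpha> * (pochhammer (1 - \<alpha>) p / fact (Suc p))"
      by (simp only: of_nat_Suc ring_distribs)
    moreover have "fps_nth (gstirling_fps \<alpha>) (Suc p) = pochhammer (1 - \<alpha>) p / fact (Suc p)"
      by (simp add: gstirling_fps_def)
    ultimately show ?thesis
      using Suc by (simp add: left_diff_distrib deriv del: fps_deriv_nth fact_Suc)
  qed
qed

lemma gstirling_conv_fps:
  "gstirling \<alpha> n k = fact n / fact k * fps_nth (gstirling_fps \<alpha> ^ k) n"
  by (simp add: gstirling_def gstirling_fps_power_nth)

text \<open>The series has no constant term, so its k-th power starts at degree k or later.\<close>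

lemma gstirling_eq_0: "n < k \<Longrightarrow> gstirling \<alpha> n k = 0"
  by (simp add: gstirling_conv_fps startsby_zero_power_prefix gstirling_fps_def)

lemma gstirling_0_0: "gstirling \<alpha> 0 0 = 1"
  by (simp add: gstirling_conv_fps)

lemma gstirling_Suc_0: "gstirling \<alpha> (Suc n) 0 = 0"
  by (simp add: gstirling_conv_fps)

text \<open>
  Comparing coefficients in $(1 - t) (f^k)' = k f^{k-1} (1 - \alpha f)$, where $f$ is
  \<^const>\<open>gstirling_fps\<close>.
\<close>

lemma gstirling_Suc_Suc:
  "gstirling \<alpha> (Suc n) (Suc k) =
     (real n - real (Suc k) * \<alpha>) * gstirling \<alpha> n (Suc k) + gstirling \<alpha> n k"
proof -
  let ?f = "gstirling_fps \<alpha>"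
  have "(1 - fps_X) * fps_deriv (?f ^ Suc k) =
      fps_const (real (Suc k)) * ?f ^ k * ((1 - fps_X) * fps_deriv ?f)"
    unfolding fps_deriv_power by (simp only: diff_Suc_1 mult_ac)
  also have "\<dots> = fps_const (real (Suc k)) * ?f ^ k - fps_const (real (Suc k) * \<alpha>) * ?f ^ Suc k"
    unfolding gstirling_fps_deriv fps_const_mult[symmetric] power_Suc
    by (simp only: right_diff_distrib mult_1_left mult_1_right mult_ac)
  finally have "fps_nth ((1 - fps_X) * fps_deriv (?f ^ Suc k)) n =
      fps_nth (fps_const (real (Suc k)) * ?f ^ k - fps_const (real (Suc k) * \<alpha>) * ?f ^ Suc k) n"
    by simp
  \<comment> \<open>At index n the coefficient of t times a derivative is n times that of the
    series, also for n = 0.\<close>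
  then have rec: "real (Suc n) * fps_nth (?f ^ Suc k) (Suc n) - real n * fps_nth (?f ^ Suc k) n =
      real (Suc k) * fps_nth (?f ^ k) n - real (Suc k) * \<alpha> * fps_nth (?f ^ Suc k) n"
    by (cases n) (simp_all add: left_diff_distrib del: power_Suc of_nat_Suc)
  have "gstirling \<alpha> (Suc n) (Suc k) =
      fact n / fact (Suc k) * (real (Suc n) * fps_nth (?f ^ Suc k) (Suc n))"
    by (simp add: gstirling_conv_fps del: power_Suc)
  also have "real (Suc n) * fps_nth (?f ^ Suc k) (Suc n) =
      (real n - real (Suc k) * \<alpha>) * fps_nth (?f ^ Suc k) n + real (Suc k) * fps_nth (?f ^ k) n"
    using rec by (simp add: algebra_simps del: power_Suc of_nat_Suc)
  finally have "gstirling \<alpha> (Suc n) (Suc k) = fact n / fact (Suc k) *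
      ((real n - real (Suc k) * \<alpha>) * fps_nth (?f ^ Suc k) n + real (Suc k) * fps_nth (?f ^ k) n)" .
  moreover have "fact n / fact (Suc k) * (real (Suc k) * x) = fact n / fact k * x" for x :: real
    by (simp del: of_nat_Suc)
  ultimately show ?thesis
    by (simp only: gstirling_conv_fps distrib_left mult.left_commute mult.assoc)
qed

section \<open>Non-central Stirling numbers\<close>

lemma gstirling_nc_eq_0: "n < k \<Longrightarrow> gstirling_nc \<alpha> \<gamma> n k = 0"
  by (simp add: gstirling_nc_def)

lemma gstirling_nc_0: "gstirling_nc \<alpha> \<gamma> 0 k = of_bool (k = 0)"
  by (simp add: gstirling_nc_def gstirling_0_0)

text \<open>A summation range independent of k lets the recurrence relate k and k - 1 without
  boundary terms.\<close>

lemma gstirling_nc_conv_atMost: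
  "gstirling_nc \<alpha> \<gamma> n k =
     (\<Sum>s\<le>n. real (n choose s) * gstirling \<alpha> s k * pochhammer (- \<gamma>) (n - s))"
  unfolding gstirling_nc_def
  by (rule sum.mono_neutral_left) (auto simp: gstirling_eq_0)

text \<open>Pascal's rule splits the sum: one half advances the central number by
  \<open>rec\<close>, the other adds a factor to the rising factorial. The inhomogeneous term
  \<open>S\<close> is left abstract so that k = 0 (with \<open>S\<close> zero) and k > 0 share the
  proof.\<close>

lemma gstirling_nc_Suc_aux:
  assumes rec: "\<And>s. gstirling \<alpha> (Suc s) k = (real s - real k * \<alpha>) * gstirling \<alpha> s k + S s"
  shows "gstirling_nc \<alpha> \<gamma> (Suc n) k = (real n - \<gamma> - real k * \<alpha>) * gstirling_nc \<alpha> \<gamma> n k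
      + (\<Sum>s\<le>n. real (n choose s) * S s * pochhammer (- \<gamma>) (n - s))"
proof -
  let ?g = "\<lambda>s. gstirling \<alpha> s k" and ?p = "pochhammer (- \<gamma>)"
  have 1: "gstirling_nc \<alpha> \<gamma> (Suc n) k = ?g 0 * ?p (Suc n)
      + (\<Sum>s\<le>n. real (n choose s) * ?g (Suc s) * ?p (n - s))
      + (\<Sum>s\<le>n. real (n choose Suc s) * ?g (Suc s) * ?p (n - s))"
    unfolding gstirling_nc_conv_atMost
    by (subst sum.atMost_Suc_shift) (simp add: ring_distribs sum.distrib)
  have 2: "?g 0 * ?p (Suc n) + (\<Sum>s\<le>n. real (n choose Suc s) * ?g (Suc s) * ?p (n - s))
      = (\<Sum>s\<le>Suc n. real (n choose s) * ?g s * ?p (Suc n - s))"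
    by (subst sum.atMost_Suc_shift) simp
  have 3: "\<dots> = (\<Sum>s\<le>n. real (n choose s) * ?g s * ?p (n - s) * (real n - real s - \<gamma>))"
    by (auto simp: Suc_diff_le pochhammer_Suc of_nat_diff algebra_simps intro!: sum.cong)
  have 4: "(\<Sum>s\<le>n. real (n choose s) * ?g (Suc s) * ?p (n - s)) =
      (\<Sum>s\<le>n. real (n choose s) * ?g s * ?p (n - s) * (real s - real k * \<alpha>))
      + (\<Sum>s\<le>n. real (n choose s) * S s * ?p (n - s))"
    unfolding rec by (simp add: sum.distrib[symmetric] algebra_simps)
  \<comment> \<open>The factors n - s - \<gamma> and s - k\<alpha> add up to a quantity free of s,
    which leaves the sum.\<close>
  have 5: "(\<Sum>s\<le>n. real (n choose s) * ?g s * ?p (n - s) * (real n - real s - \<gamma>))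
      + (\<Sum>s\<le>n. real (n choose s) * ?g s * ?p (n - s) * (real s - real k * \<alpha>))
      = (real n - \<gamma> - real k * \<alpha>) * gstirling_nc \<alpha> \<gamma> n k"
    unfolding gstirling_nc_conv_atMost sum_distrib_left sum.distrib[symmetric]
    by (simp add: algebra_simps)
  show ?thesis
    using 1 2 3 4 5 by linarith
qed

lemma gstirling_nc_Suc_0:
  "gstirling_nc \<alpha> \<gamma> (Suc n) 0 = (real n - \<gamma>) * gstirling_nc \<alpha> \<gamma> n 0"
proof -
  have "gstirling \<alpha> (Suc s) 0 = (real s - real 0 * \<alpha>) * gstirling \<alpha> s 0 + 0" for s
    by (cases s) (simp_all add: gstirling_Suc_0)
  from gstirling_nc_Suc_aux[OF this] show ?thesis by simp
qed

lemma gstirling_nc_Suc_Suc: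
  "gstirling_nc \<alpha> \<gamma> (Suc n) (Suc k) =
     (real n - \<gamma> - real (Suc k) * \<alpha>) * gstirling_nc \<alpha> \<gamma> n (Suc k) + gstirling_nc \<alpha> \<gamma> n k"
  using gstirling_nc_Suc_aux[OF gstirling_Suc_Suc] by (simp add: gstirling_nc_conv_atMost)

text \<open>A form uniform in k for the induction on m; the indicator masks the truncated
  \<open>k - 1\<close> at k = 0.\<close>

lemma gstirling_nc_Suc:
  "gstirling_nc \<alpha> \<gamma> (Suc n) k = (real n - \<gamma> - real k * \<alpha>) * gstirling_nc \<alpha> \<gamma> n k
     + of_bool (k \<noteq> 0) * gstirling_nc \<alpha> \<gamma> n (k - 1)"
  by (cases k) (simp_all only: gstirling_nc_Suc_0 gstirling_nc_Suc_Suc, simp_all)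

section \<open>Extensions of a partition\<close>

lemma partition_on_restrict_partition:
  assumes "partition_on S P" "{1..N} \<subseteq> S"
  shows "partition_on {1..N} (restrict_partition N P)"
proof -
  have "(\<lambda>B. B \<inter> {1..N}) = (\<inter>) {1..N}" by (rule ext) (rule Int_commute)
  then show ?thesis
    using partition_on_restrict[OF assms(1), of "{1..N}"] Int_absorb2[OF assms(2)]
    by (simp only: restrict_partition_def)
qed

lemma restrict_restrict_partition:
  assumes "n \<le> N"
  shows "restrict_partition n (restrict_partition N P) = restrict_partition n P"
proof -
  have "B \<inter> {1..N} \<inter> {1..n} = B \<inter> {1..n}" for B using assms by auto
  then have *: "(\<lambda>B. B \<inter> {1..n}) ` (\<lambda>B. B \<inter> {1..N}) ` P = (\<lambda>B. B \<inter> {1..n}) ` P"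
    by (simp only: image_image)
  \<comment> \<open>A trace that is empty on {1..N} is also empty on {1..n}, so discarding it early
    changes nothing in the end.\<close>
  have "restrict_partition n (restrict_partition N P) =
      (\<lambda>B. B \<inter> {1..n}) ` (\<lambda>B. B \<inter> {1..N}) ` P - {{}}"
    unfolding restrict_partition_def by auto
  then show ?thesis
    by (simp only: * restrict_partition_def)
qed

lemma restrict_partition_id:
  assumes "partition_on {1..N} P"
  shows "restrict_partition N P = P"
proof -
  have "B \<inter> {1..N} = B" if "B \<in> P" for B
    using partition_onD1[OF assms] that by auto
  then have "(\<lambda>B. B \<inter> {1..N}) ` P = P" by force
  then show ?thesis
    using partition_onD3[OF assms] by (simp add: restrict_partition_def)
qed

text \<open>
  Taking \<open>X = {}\<close> opens a new block: a partition never contains \<open>{}\<close>, so removing it has no effect.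
\<close>

definition add_to_block :: "nat \<Rightarrow> nat set set \<Rightarrow> nat set \<Rightarrow> nat set set" where
  "add_to_block N Q X = insert (insert (Suc N) X) (Q - {X})"

lemma partition_blocks:
  assumes "partition_on {1..N} Q" "B \<in> Q"
  shows "B \<noteq> {}" "B \<subseteq> {1..N}" "Suc N \<notin> B" "finite B" "0 < card B"
proof -
  show "B \<noteq> {}" using partition_onD3[OF assms(1)] assms(2) by auto
  show "B \<subseteq> {1..N}" using partition_onD1[OF assms(1)] assms(2) by auto
  then show "Suc N \<notin> B" "finite B" by (auto intro: finite_subset)
  with \<open>B \<noteq> {}\<close> show "0 < card B" by (simp add: card_gt_0_iff)
qed

lemma partition_block_unique:
  assumes "partition_on S Q" "B \<in> Q" "C \<in> Q" "x \<in> B" "x \<in> C"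
  shows "B = C"
  using disjointD[OF partition_onD2[OF assms(1)] assms(2,3)] assms(4,5) by auto

lemma sum_card_partition:
  assumes "partition_on {1..N} Q"
  shows "(\<Sum>B\<in>Q. card B) = N"
proof -
  have "card {1..N} = (\<Sum>B\<in>Q. card B)"
    unfolding partition_onD1[OF assms]
    by (rule card_Union_disjoint)
      (use partition_onD2[OF assms] partition_blocks(4)[OF assms] in
        \<open>auto simp: disjoint_def pairwise_def disjnt_def\<close>)
  then show ?thesis by simp
qed

lemma card_partition_le:
  assumes "partition_on {1..N} Q"
  shows "card Q \<le> N"
proof -
  have "card Q = (\<Sum>B\<in>Q. 1)" by simp
  also have "\<dots> \<le> (\<Sum>B\<in>Q. card B)"
    by (rule sum_mono) (use partition_blocks(5)[OF assms] in \<open>simp add: Suc_le_eq\<close>)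
  finally show ?thesis by (simp add: sum_card_partition[OF assms])
qed

lemma partition_on_add_to_block:
  assumes Q: "partition_on {1..N} Q" and X: "X \<in> insert {} Q"
  shows "partition_on {1..Suc N} (add_to_block N Q X)"
proof (rule partition_onI)
  have "\<Union> (add_to_block N Q X) = insert (Suc N) (\<Union>Q)"
    using X by (auto simp: add_to_block_def)
  then show "\<Union> (add_to_block N Q X) = {1..Suc N}"
    unfolding partition_onD1[OF Q, symmetric] by auto
next
  show "{} \<notin> add_to_block N Q X"
    using partition_blocks(1)[OF Q] by (auto simp: add_to_block_def)
next
  fix B C assume BC: "B \<in> add_to_block N Q X" "C \<in> add_to_block N Q X" "B \<noteq> C"
  have *: "disjnt (insert (Suc N) X) C" if "C \<in> Q - {X}" for C
    using X that partition_blocks(3)[OF Q, of C] partition_block_unique[OF Q, of X C]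
    by (auto simp: disjnt_def)
  have **: "disjnt C (insert (Suc N) X)" if "C \<in> Q - {X}" for C
    using *[OF that] by (rule disjnt_sym)
  have "disjnt B C" if "B \<in> Q" "C \<in> Q" "B \<noteq> C" for B C
    using that partition_block_unique[OF Q, of B C] by (auto simp: disjnt_def)
  with BC * ** show "disjnt B C"
    unfolding add_to_block_def by blast
qed

lemma restrict_add_to_block:
  assumes Q: "partition_on {1..N} Q" and X: "X \<in> insert {} Q"
  shows "restrict_partition N (add_to_block N Q X) = Q"
proof -
  have "(\<lambda>B. B \<inter> {1..N}) ` (Q - {X}) = (\<lambda>B. B) ` (Q - {X})"
    using partition_blocks(2)[OF Q] by (intro image_cong) (simp_all add: Int_absorb2)
  moreover have "insert (Suc N) X \<inter> {1..N} = X"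
    using X partition_blocks(2)[OF Q, of X] by auto
  ultimately have "(\<lambda>B. B \<inter> {1..N}) ` add_to_block N Q X = insert X (Q - {X})"
    unfolding add_to_block_def image_insert by (simp only: image_ident)
  then show ?thesis
    using X partition_onD3[OF Q] by (auto simp: restrict_partition_def)
qed

text \<open>The block that contains N + 1 determines \<open>X\<close>.\<close>

lemma inj_on_add_to_block:
  assumes Q: "partition_on {1..N} Q"
  shows "inj_on (add_to_block N Q) (insert {} Q)"
proof (rule inj_onI)
  fix X Y assume X: "X \<in> insert {} Q" and Y: "Y \<in> insert {} Q"
    and eq: "add_to_block N Q X = add_to_block N Q Y"
  have new: "Suc N \<notin> Z" if "Z \<in> insert {} Q" for Z
    using that partition_blocks(3)[OF Q] by auto
  have "insert (Suc N) X \<in> add_to_block N Q Y"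
    unfolding eq[symmetric] by (simp add: add_to_block_def)
  moreover have "insert (Suc N) X \<notin> Q" using new by blast
  ultimately have "insert (Suc N) X = insert (Suc N) Y"
    unfolding add_to_block_def by blast
  then show "X = Y" using new[OF X] new[OF Y] by (metis insert_ident)
qed

text \<open>The witness is the trace on {1..N} of the block containing N + 1; it is empty exactly
  when N + 1 forms a singleton.\<close>

lemma add_to_block_surj:
  assumes R: "partition_on {1..Suc N} R"
  shows "\<exists>X\<in>insert {} (restrict_partition N R). R = add_to_block N (restrict_partition N R) X"
proof -
  obtain B where B: "B \<in> R" "Suc N \<in> B"
    using partition_onD1[OF R] by (metis UnionE atLeastAtMost_iff le_add1 order_refl plus_1_eq_Suc)
  have C: "C \<subseteq> {1..N}" "C \<noteq> {}" if "C \<in> R" "C \<noteq> B" for C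
  proof -
    have "Suc N \<notin> C" using partition_block_unique[OF R that(1) B(1) _ B(2)] that(2) by blast
    with partition_blocks(2)[OF R that(1)] show "C \<subseteq> {1..N}"
      by (auto simp: subset_iff le_Suc_eq)
    show "C \<noteq> {}" by (rule partition_blocks(1)[OF R that(1)])
  qed
  define X where "X = B \<inter> {1..N}"
  have BX: "B = insert (Suc N) X"
    using B(2) partition_blocks(2)[OF R B(1)] by (auto simp: X_def le_Suc_eq)
  have "R = insert B (R - {B})" using B(1) by auto
  moreover have "(\<lambda>C. C \<inter> {1..N}) ` (R - {B}) = R - {B}"
    using C(1) by (force simp: image_iff Int_absorb2)
  moreover have "{} \<notin> R - {B}" using C(2) by auto
  ultimately have rest: "restrict_partition N R = insert X (R - {B}) - {{}}"
    unfolding restrict_partition_def by (metis X_def image_insert)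
  \<comment> \<open>Otherwise removing \<open>X\<close> from the restriction would also delete an
    untouched block of \<open>R\<close>. Such a block would be nonempty and meet
    \<open>B\<close>.\<close>
  have "X \<notin> R - {B}"
  proof
    assume "X \<in> R - {B}"
    moreover from this C(2)[of X] obtain x where "x \<in> X" by auto
    ultimately show False
      using partition_block_unique[OF R _ B(1), of X x] by (auto simp: X_def)
  qed
  then have "R - {B} = restrict_partition N R - {X}"
    unfolding rest using \<open>{} \<notin> R - {B}\<close> by auto
  then have "R = add_to_block N (restrict_partition N R) X"
    using B(1) BX by (auto simp: add_to_block_def)
  moreover have "X \<in> insert {} (restrict_partition N R)" unfolding rest by auto
  ultimately show ?thesis by blast
qed

section \<open>Enumeration and weights of extensions\<close>

definition extensions :: "nat \<Rightarrow> nat \<Rightarrow> nat set set \<Rightarrow> nat set set set" where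
  "extensions n m P = {Q. partition_on {1..n + m} Q \<and> restrict_partition n Q = P}"

lemma finite_extensions: "finite (extensions n m P)"
  unfolding extensions_def
  by (rule finite_subset[OF _ finitely_many_partition_on[of "{1..n + m}"]]) auto

lemma extensions_0:
  assumes "partition_on {1..n} P"
  shows "extensions n 0 P = {P}"
  using assms by (auto simp: extensions_def restrict_partition_id)

lemma extensions_Suc_0:
  assumes "partition_on {1..N} Q"
  shows "extensions N (Suc 0) Q = add_to_block N Q ` insert {} Q"
proof (intro equalityI subsetI)
  fix R assume "R \<in> extensions N (Suc 0) Q"
  then show "R \<in> add_to_block N Q ` insert {} Q"
    using add_to_block_surj[of N R] by (auto simp: extensions_def)
next
  fix R assume "R \<in> add_to_block N Q ` insert {} Q"
  then show "R \<in> extensions N (Suc 0) Q"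
    using partition_on_add_to_block[OF assms] restrict_add_to_block[OF assms]
    by (auto simp: extensions_def)
qed

lemma sum_extensions_Suc_0:
  assumes "partition_on {1..N} Q"
  shows "(\<Sum>R\<in>extensions N (Suc 0) Q. g R) =
     g (add_to_block N Q {}) + (\<Sum>B\<in>Q. g (add_to_block N Q B) :: real)"
proof -
  have "finite Q" "{} \<notin> Q"
    using assms finite_elements[of "{1..N}"] partition_onD3 by auto
  then show ?thesis
    unfolding extensions_Suc_0[OF assms] sum.reindex[OF inj_on_add_to_block[OF assms]]
    by simp
qed

text \<open>Extensions by m + 1 integers are grouped by their restriction to {1..n + m}; the groups
  are disjoint since each extension has one restriction.\<close>

lemma sum_extensions_Suc:
  "(\<Sum>R\<in>extensions n (Suc m) P. g R :: real) =
     (\<Sum>Q\<in>extensions n m P. \<Sum>R\<in>extensions (n + m) (Suc 0) Q. g R)"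
proof -
  have "extensions n (Suc m) P = (\<Union>Q\<in>extensions n m P. extensions (n + m) (Suc 0) Q)"
  proof (intro equalityI subsetI)
    fix R assume "R \<in> extensions n (Suc m) P"
    then show "R \<in> (\<Union>Q\<in>extensions n m P. extensions (n + m) (Suc 0) Q)"
      using partition_on_restrict_partition[of "{1..Suc (n + m)}" R "n + m"]
      by (auto simp: extensions_def restrict_restrict_partition
          intro!: exI[of _ "restrict_partition (n + m) R"])
  next
    fix R assume "R \<in> (\<Union>Q\<in>extensions n m P. extensions (n + m) (Suc 0) Q)"
    then show "R \<in> extensions n (Suc m) P"
      using restrict_restrict_partition[of n "n + m" R] by (auto simp: extensions_def)
  qed
  moreover have "(\<Sum>R\<in>(\<Union>Q\<in>extensions n m P. extensions (n + m) (Suc 0) Q). g R) =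
      (\<Sum>Q\<in>extensions n m P. \<Sum>R\<in>extensions (n + m) (Suc 0) Q. g R)"
    by (rule sum.UNION_disjoint) (auto simp: finite_extensions, auto simp: extensions_def)
  ultimately show ?thesis by simp
qed

text \<open>The part of the Gibbs probability that depends on block sizes. The other factor V
  depends only on the number of blocks, so it can be attached after the weights have been
  summed.\<close>

definition block_weight :: "real \<Rightarrow> nat set set \<Rightarrow> real" where
  "block_weight \<alpha> Q = (\<Prod>B\<in>Q. pochhammer (1 - \<alpha>) (card B - 1))"

lemma block_weight_pos:
  assumes "\<alpha> < 1"
  shows "0 < block_weight \<alpha> Q"
  using assms by (auto simp: block_weight_def intro!: prod_pos pochhammer_pos)

lemma block_weight_add_to_block:
  assumes Q: "partition_on {1..N} Q"
  shows "block_weight \<alpha> (add_to_block N Q {}) = block_weight \<alpha> Q" (is ?new)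
    and "B \<in> Q \<Longrightarrow> block_weight \<alpha> (add_to_block N Q B) = block_weight \<alpha> Q * (real (card B) - \<alpha>)"
proof -
  have fin: "finite Q" using finite_elements[OF _ Q] by simp
  have notin: "insert (Suc N) X \<notin> Q" for X using partition_blocks(3)[OF Q] by blast
  show ?new
    using fin notin[of "{}"] partition_onD3[OF Q] by (simp add: block_weight_def add_to_block_def)
  assume B: "B \<in> Q"
  obtain c where c: "card B = Suc c" using partition_blocks(5)[OF Q B] by (cases "card B") auto
  have "block_weight \<alpha> (add_to_block N Q B) =
      pochhammer (1 - \<alpha>) (Suc c) * block_weight \<alpha> (Q - {B})"
    using fin notin[of B] partition_blocks(3,4)[OF Q B] c
    by (simp add: block_weight_def add_to_block_def)
  moreover have "block_weight \<alpha> Q = pochhammer (1 - \<alpha>) c * block_weight \<alpha> (Q - {B})"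
    unfolding block_weight_def by (subst prod.remove[OF fin B]) (simp add: c)
  ultimately show "block_weight \<alpha> (add_to_block N Q B) = block_weight \<alpha> Q * (real (card B) - \<alpha>)"
    using c by (simp add: pochhammer_Suc algebra_simps)
qed

section \<open>Old and new blocks of an extension\<close>

lemma extensionsD:
  assumes "Q \<in> extensions n m P"
  shows "partition_on {1..n + m} Q" "restrict_partition n Q = P"
  using assms by (auto simp: extensions_def)

lemma add_to_block_in_extensions:
  assumes Q: "Q \<in> extensions n m P" and X: "X \<in> insert {} Q"
  shows "add_to_block (n + m) Q X \<in> extensions n (Suc m) P"
  using partition_on_add_to_block[OF extensionsD(1)[OF Q] X]
    restrict_add_to_block[OF extensionsD(1)[OF Q] X] extensionsD(2)[OF Q]
    restrict_restrict_partition[of n "n + m" "add_to_block (n + m) Q X"]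
  by (auto simp: extensions_def)

text \<open>At most one block contains a given nonempty set, so the union selects it without a
  choice operator.\<close>

definition old_block :: "nat set set \<Rightarrow> nat set \<Rightarrow> nat set" where
  "old_block Q a = \<Union> {B \<in> Q. a \<subseteq> B}"

lemma old_block_eq:
  assumes Q: "partition_on S Q" and B: "B \<in> Q" "a \<subseteq> B" and a: "a \<noteq> {}"
  shows "old_block Q a = B"
proof -
  obtain x where "x \<in> a" using a by auto
  then have "{B \<in> Q. a \<subseteq> B} = {B}"
    using B partition_block_unique[OF Q _ B(1), of _ x] by auto
  then show ?thesis by (simp add: old_block_def)
qed

lemma old_block_extension:
  assumes Q: "Q \<in> extensions n m P" and P: "partition_on {1..n} P" and a: "a \<in> P"
  shows "old_block Q a \<in> Q" "old_block Q a \<inter> {1..n} = a"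
proof -
  have "a \<in> restrict_partition n Q" using extensionsD(2)[OF Q] a by simp
  then obtain B where B: "B \<in> Q" "a = B \<inter> {1..n}"
    by (auto simp: restrict_partition_def)
  then have "old_block Q a = B"
    using old_block_eq[OF extensionsD(1)[OF Q], of B a] partition_blocks(1)[OF P a] by auto
  with B show "old_block Q a \<in> Q" "old_block Q a \<inter> {1..n} = a" by auto
qed

lemma bij_betw_old_block:
  assumes Q: "Q \<in> extensions n m P" and P: "partition_on {1..n} P"
  shows "bij_betw (old_block Q) P {B \<in> Q. B \<inter> {1..n} \<noteq> {}}"
proof (rule bij_betw_byWitness[where f' = "\<lambda>B. B \<inter> {1..n}"])
  show "\<forall>a\<in>P. old_block Q a \<inter> {1..n} = a"
    using old_block_extension(2)[OF Q P] by blast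
  show "\<forall>B\<in>{B \<in> Q. B \<inter> {1..n} \<noteq> {}}. old_block Q (B \<inter> {1..n}) = B"
    using old_block_eq[OF extensionsD(1)[OF Q]] by blast
  show "old_block Q ` P \<subseteq> {B \<in> Q. B \<inter> {1..n} \<noteq> {}}"
    using old_block_extension[OF Q P] partition_blocks(1)[OF P] by fastforce
  show "(\<lambda>B. B \<inter> {1..n}) ` {B \<in> Q. B \<inter> {1..n} \<noteq> {}} \<subseteq> P"
    using extensionsD(2)[OF Q] by (auto simp: restrict_partition_def)
qed

text \<open>Blocks meeting {1..n} correspond to blocks of \<open>P\<close> by taking traces. Thus
  the index j + K_m of the weights V is simply the number of blocks of \<open>Q\<close>.\<close>

lemma card_extension:
  assumes Q: "Q \<in> extensions n m P" and P: "partition_on {1..n} P"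
  shows "card Q = card P + new_blocks n m Q"
proof -
  have "finite Q" using finite_elements[OF _ extensionsD(1)[OF Q]] by simp
  then have "card Q = card ({B \<in> Q. B \<inter> {1..n} \<noteq> {}} \<union> {B \<in> Q. B \<inter> {1..n} = {}})"
    by (intro arg_cong[where f = card]) auto
  also have "\<dots> = card {B \<in> Q. B \<inter> {1..n} \<noteq> {}} + card {B \<in> Q. B \<inter> {1..n} = {}}"
    by (rule card_Un_disjoint) (use \<open>finite Q\<close> in auto)
  also have "card {B \<in> Q. B \<inter> {1..n} \<noteq> {}} = card P"
    using bij_betw_same_card[OF bij_betw_old_block[OF Q P]] by simp
  finally show ?thesis
    by (simp add: new_blocks_def restrict_partition_id[OF extensionsD(1)[OF Q]])
qed

lemma card_old_block:
  assumes Q: "Q \<in> extensions n m P" and P: "partition_on {1..n} P" and a: "A i \<in> P"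
  shows "card (old_block Q (A i)) = card (A i) + old_block_gain n m A i Q"
proof -
  let ?b = "old_block Q (A i)"
  have b: "?b \<subseteq> {1..n + m}"
    by (rule partition_blocks(2)[OF extensionsD(1)[OF Q] old_block_extension(1)[OF Q P a]])
  have "?b = (?b \<inter> {1..n}) \<union> (?b \<inter> {n + 1..n + m})"
    using b by fastforce
  then have "card ?b = card ((?b \<inter> {1..n}) \<union> (?b \<inter> {n + 1..n + m}))"
    by simp
  also have "\<dots> = card (?b \<inter> {1..n}) + card (?b \<inter> {n + 1..n + m})"
    by (rule card_Un_disjoint) auto
  also have "?b \<inter> {n + 1..n + m} = {x \<in> {n + 1..n + m}. \<exists>B\<in>Q. A i \<subseteq> B \<and> x \<in> B}"
    by (auto simp: old_block_def)
  also have "?b \<inter> {1..n} = A i"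
    by (rule old_block_extension(2)[OF Q P a])
  finally show ?thesis
    by (simp only: old_block_gain_def)
qed

section \<open>Effect of one added integer on the block counts\<close>

lemma card_add_to_block:
  assumes Q: "partition_on {1..N} Q"
  shows "card (add_to_block N Q {}) = Suc (card Q)"
    and "B \<in> Q \<Longrightarrow> card (add_to_block N Q B) = card Q"
proof -
  have fin: "finite Q" using finite_elements[OF _ Q] by simp
  have notin: "insert (Suc N) X \<notin> Q" for X using partition_blocks(3)[OF Q] by blast
  show "card (add_to_block N Q {}) = Suc (card Q)"
    using fin notin partition_onD3[OF Q] by (simp add: add_to_block_def)
  show "card (add_to_block N Q B) = card Q" if "B \<in> Q"
    using fin notin that card_Suc_Diff1[OF fin that] by (simp add: add_to_block_def)
qed

text \<open>The number of old blocks is fixed at |P|, so every change in the total number of blocks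
  is a change in the number of new ones.\<close>

lemma new_blocks_add_to_block:
  assumes Q: "Q \<in> extensions n m P" and P: "partition_on {1..n} P"
  shows "new_blocks n (Suc m) (add_to_block (n + m) Q {}) = Suc (new_blocks n m Q)"
    and "B \<in> Q \<Longrightarrow> new_blocks n (Suc m) (add_to_block (n + m) Q B) = new_blocks n m Q"
  using card_extension[OF Q P] card_extension[OF add_to_block_in_extensions[OF Q] P]
    card_add_to_block[OF extensionsD(1)[OF Q]] by auto

lemma old_block_add_to_block:
  assumes Q: "Q \<in> extensions n m P" and P: "partition_on {1..n} P" and a: "a \<in> P"
    and X: "X \<in> insert {} Q"
  shows "old_block (add_to_block (n + m) Q X) a =
     (if X = old_block Q a then insert (Suc (n + m)) X else old_block Q a)"
proof -
  have "a \<subseteq> old_block Q a" using old_block_extension(2)[OF Q P a] by blast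
  then show ?thesis
    using old_block_extension(1)[OF Q P a] partition_blocks(1)[OF P a]
    by (intro old_block_eq[OF partition_on_add_to_block[OF extensionsD(1)[OF Q] X]])
      (auto simp: add_to_block_def)
qed

lemma old_block_gain_add_to_block:
  assumes Q: "Q \<in> extensions n m P" and P: "partition_on {1..n} P" and a: "A i \<in> P"
    and X: "X \<in> insert {} Q"
  shows "old_block_gain n (Suc m) A i (add_to_block (n + m) Q X) =
     old_block_gain n m A i Q + of_bool (X = old_block Q (A i))"
proof -
  note b = partition_blocks[OF extensionsD(1)[OF Q] old_block_extension(1)[OF Q P a]]
  have "card (old_block (add_to_block (n + m) Q X) (A i)) =
      card (old_block Q (A i)) + of_bool (X = old_block Q (A i))"
    using b(3,4) by (auto simp: old_block_add_to_block[OF Q P a X])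
  then show ?thesis
    by (simp add: card_old_block[where A = A, OF Q P a]
        card_old_block[where A = A, OF add_to_block_in_extensions[OF Q X] P a])
qed

text \<open>The summands belong to the three possible predecessor states. In the last coefficient,
  the blocks other than the i-th contain n + m - c - r integers, and each of these |P| + k - 1
  blocks contributes -\<alpha>. Indicators mask \<open>k - 1\<close> and \<open>r - 1\<close> at
  0.\<close>

lemma sum_block_weight_Suc_0:
  fixes A :: "nat \<Rightarrow> nat set" and \<alpha> :: real
  assumes Q: "Q \<in> extensions n m P" and P: "partition_on {1..n} P" and a: "A i \<in> P"
  defines "c \<equiv> real (card (A i))"
  defines "I \<equiv> \<lambda>m r k Q. of_bool (old_block_gain n m A i Q = r \<and> new_blocks n m Q = k) :: real"
  shows "(\<Sum>R\<in>extensions (n + m) (Suc 0) Q. block_weight \<alpha> R * I (Suc m) r k R) =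
    block_weight \<alpha> Q * (of_bool (k \<noteq> 0) * I m r (k - 1) Q
      + of_bool (r \<noteq> 0) * (c + real (r - 1) - \<alpha>) * I m (r - 1) k Q
      + (real (n + m) - c - real r - (real (card P) + real k - 1) * \<alpha>) * I m r k Q)"
proof -
  let ?w = "block_weight \<alpha> Q" and ?b = "old_block Q (A i)"
  let ?g = "old_block_gain n m A i Q" and ?k = "new_blocks n m Q"
  note Qp = extensionsD(1)[OF Q]
  have fin: "finite Q" using finite_elements[OF _ Qp] by simp
  have b: "?b \<in> Q" by (rule old_block_extension(1)[OF Q P a])
  \<comment> \<open>Opening a block is encoded by \<open>X = {}\<close>, which must not be mistaken
    for joining the i-th old block.\<close>
  have "{} \<noteq> ?b" using partition_blocks(1)[OF Qp b] by blast
  then have new: "block_weight \<alpha> (add_to_block (n + m) Q {}) * I (Suc m) r k (add_to_block (n + m) Q {}) =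
      ?w * (of_bool (k \<noteq> 0) * I m r (k - 1) Q)"
    by (cases k) (simp_all add: I_def block_weight_add_to_block(1)[OF Qp]
        old_block_gain_add_to_block[where A = A, OF Q P a] new_blocks_add_to_block(1)[OF Q P])
  have old: "block_weight \<alpha> (add_to_block (n + m) Q B) * I (Suc m) r k (add_to_block (n + m) Q B) =
      ?w * ((real (card B) - \<alpha>) * of_bool (?g + of_bool (B = ?b) = r \<and> ?k = k))" if "B \<in> Q" for B
    using that by (simp add: I_def block_weight_add_to_block(2)[OF Qp]
        old_block_gain_add_to_block[where A = A, OF Q P a] new_blocks_add_to_block(2)[OF Q P])
  have "(\<Sum>B\<in>Q. (real (card B) - \<alpha>) * of_bool (?g + of_bool (B = ?b) = r \<and> ?k = k)) =
      (real (card ?b) - \<alpha>) * of_bool (Suc ?g = r \<and> ?k = k)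
      + (\<Sum>B\<in>Q - {?b}. (real (card B) - \<alpha>) * I m r k Q)"
    unfolding sum.remove[OF fin b] by (simp add: I_def)
  also have "(\<Sum>B\<in>Q - {?b}. (real (card B) - \<alpha>) * I m r k Q) =
      (real (n + m) - real (card ?b) - (real (card Q) - 1) * \<alpha>) * I m r k Q"
  proof -
    have "(\<Sum>B\<in>Q. real (card B) - \<alpha>) = real (n + m) - real (card Q) * \<alpha>"
      using arg_cong[OF sum_card_partition[OF Qp], of real] by (simp add: sum_subtractf)
    with sum.remove[OF fin b, of "\<lambda>B. real (card B) - \<alpha>"]
    have "(\<Sum>B\<in>Q - {?b}. real (card B) - \<alpha>) =
        real (n + m) - real (card ?b) - (real (card Q) - 1) * \<alpha>"
      by (simp add: left_diff_distrib)
    then show ?thesis by (simp only: sum_distrib_right[symmetric])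
  qed
  also have "(real (card ?b) - \<alpha>) * of_bool (Suc ?g = r \<and> ?k = k) =
      of_bool (r \<noteq> 0) * (c + real (r - 1) - \<alpha>) * I m (r - 1) k Q"
    by (cases r) (auto simp: I_def c_def card_old_block[where A = A, OF Q P a])
  also have "(real (n + m) - real (card ?b) - (real (card Q) - 1) * \<alpha>) * I m r k Q =
      (real (n + m) - c - real r - (real (card P) + real k - 1) * \<alpha>) * I m r k Q"
    by (auto simp: I_def c_def card_old_block[where A = A, OF Q P a] card_extension[OF Q P])
  finally have sum_old: "(\<Sum>B\<in>Q. (real (card B) - \<alpha>) *
      of_bool (?g + of_bool (B = ?b) = r \<and> ?k = k)) =
      of_bool (r \<noteq> 0) * (c + real (r - 1) - \<alpha>) * I m (r - 1) k Q
      + (real (n + m) - c - real r - (real (card P) + real k - 1) * \<alpha>) * I m r k Q" .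
  have "(\<Sum>B\<in>Q. block_weight \<alpha> (add_to_block (n + m) Q B) * I (Suc m) r k (add_to_block (n + m) Q B)) =
      ?w * (\<Sum>B\<in>Q. (real (card B) - \<alpha>) * of_bool (?g + of_bool (B = ?b) = r \<and> ?k = k))"
    unfolding sum_distrib_left by (rule sum.cong[OF refl]) (rule old)
  then show ?thesis
    unfolding sum_extensions_Suc_0[OF Qp] new sum_old by (simp only: distrib_left add.assoc)
qed

text \<open>
  The next integer either opens a new block, joins block \<open>i\<close>, or joins one of the other blocks, whose
  total weight is fixed by \<open>r\<close> and \<open>k\<close>. Pascal's rule for \<open>m choose r\<close> and the recurrence of the
  non-central Stirling numbers solve the resulting recurrence in \<open>m\<close>.
\<close>

lemma sum_block_weight_class:
  fixes A :: "nat \<Rightarrow> nat set" and \<alpha> :: real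
  assumes P: "partition_on {1..n} P" and a: "A i \<in> P"
  shows "(\<Sum>Q\<in>extensions n m P. block_weight \<alpha> Q *
        of_bool (old_block_gain n m A i Q = r \<and> new_blocks n m Q = k)) =
     block_weight \<alpha> P * (real (m choose r) * pochhammer (real (card (A i)) - \<alpha>) r *
       gstirling_nc \<alpha> (- (real n - real (card P) * \<alpha> - real (card (A i)) + \<alpha>)) (m - r) k)"
proof (induction m arbitrary: r k)
  case 0
  have "P \<in> extensions n 0 P" using extensions_0[OF P] by simp
  then have "new_blocks n 0 P = 0" using card_extension[OF _ P] by force
  moreover have "old_block_gain n 0 A i P = 0" by (simp add: old_block_gain_def)
  ultimately show ?case
    unfolding extensions_0[OF P] by (cases r) (auto simp: gstirling_nc_0)
next
  case (Suc m)
  define c where "c = real (card (A i))"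
  define \<gamma> where "\<gamma> = - (real n - real (card P) * \<alpha> - c + \<alpha>)"
  define I where "I = (\<lambda>m r k Q. of_bool (old_block_gain n m A i Q = r \<and> new_blocks n m Q = k) :: real)"
  let ?F = "\<lambda>m r k. \<Sum>Q\<in>extensions n m P. block_weight \<alpha> Q * I m r k Q"
  let ?G = "\<lambda>m r k. real (m choose r) * pochhammer (c - \<alpha>) r * gstirling_nc \<alpha> \<gamma> (m - r) k"
  have IH: "?F m r k = block_weight \<alpha> P * ?G m r k" for r k
    using Suc.IH by (simp add: I_def c_def \<gamma>_def)
  have linear: "(\<Sum>Q\<in>E. w Q * (x * f Q + y * g Q + z * h Q)) =
      x * (\<Sum>Q\<in>E. w Q * f Q) + y * (\<Sum>Q\<in>E. w Q * g Q) + z * (\<Sum>Q\<in>E. w Q * h Q)"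
    for E :: "nat set set set" and w f g h :: "nat set set \<Rightarrow> real" and x y z
    unfolding sum_distrib_left sum.distrib[symmetric] by (simp add: algebra_simps)
  have "?F (Suc m) r k = (\<Sum>Q\<in>extensions n m P.
      block_weight \<alpha> Q * (of_bool (k \<noteq> 0) * I m r (k - 1) Q
      + of_bool (r \<noteq> 0) * (c + real (r - 1) - \<alpha>) * I m (r - 1) k Q
      + (real (n + m) - c - real r - (real (card P) + real k - 1) * \<alpha>) * I m r k Q))"
    unfolding sum_extensions_Suc[where n = n and m = m and P = P] I_def c_def
    by (rule sum.cong[OF refl]) (rule sum_block_weight_Suc_0[where A = A, OF _ P a])
  also have "\<dots> = of_bool (k \<noteq> 0) * ?F m r (k - 1)
      + of_bool (r \<noteq> 0) * (c + real (r - 1) - \<alpha>) * ?F m (r - 1) k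
      + (real (n + m) - c - real r - (real (card P) + real k - 1) * \<alpha>) * ?F m r k"
    by (rule linear)
  also have "\<dots> = block_weight \<alpha> P * (of_bool (k \<noteq> 0) * ?G m r (k - 1)
      + of_bool (r \<noteq> 0) * (c + real (r - 1) - \<alpha>) * ?G m (r - 1) k
      + (real (n + m) - c - real r - (real (card P) + real k - 1) * \<alpha>) * ?G m r k)"
    unfolding IH by (simp only: distrib_left mult.left_commute[of _ "block_weight \<alpha> P"])
  also have "of_bool (k \<noteq> 0) * ?G m r (k - 1)
      + of_bool (r \<noteq> 0) * (c + real (r - 1) - \<alpha>) * ?G m (r - 1) k
      + (real (n + m) - c - real r - (real (card P) + real k - 1) * \<alpha>) * ?G m r k = ?G (Suc m) r k"
  proof (cases r)
    case 0
    then show ?thesis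
      by (simp add: gstirling_nc_Suc \<gamma>_def algebra_simps)
  next
    case (Suc r')
    show ?thesis
    proof (cases "r \<le> m")
      case True
      then obtain q where q: "m = r + q" using le_Suc_ex by blast
      with Suc have eqs: "m - r = q" "r - 1 = r'" "m - r' = Suc q" "Suc m - r = Suc q"
        by auto
      \<comment> \<open>This equation dictates \<gamma>: after r of the m integers have gone to the
        i-th block, the remaining coefficient must be the one in the recurrence at q = m -
        r.\<close>
      have coeff: "real (n + m) - c - real r - (real (card P) + real k - 1) * \<alpha> =
          real q - \<gamma> - real k * \<alpha>"
        by (simp add: q \<gamma>_def algebra_simps)
      have binom: "real (Suc m choose r) = real (m choose r') + real (m choose r)"
        by (simp add: Suc)
      have poch: "pochhammer (c - \<alpha>) r = pochhammer (c - \<alpha>) r' * (c + real r' - \<alpha>)"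
        by (simp add: Suc pochhammer_Suc algebra_simps)
      have one: "of_bool (r \<noteq> 0) = (1 :: real)" using Suc by simp
      \<comment> \<open>The (r - 1)-term already has Stirling index q + 1, so it supplies the
        \<open>m choose r'\<close> half of Pascal's rule; the other two terms supply the
        \<open>m choose r\<close> half by the recurrence.\<close>
      show ?thesis
        unfolding eqs coeff binom poch one gstirling_nc_Suc[of \<alpha> \<gamma> q k]
        by (simp only: mult_1_left distrib_left distrib_right mult_ac add_ac)
    next
      case False
      \<comment> \<open>For r = m + 1 only the (r - 1)-term survives, with binomial coefficient 1;
        for larger r everything is 0.\<close>
      then show ?thesis
        using Suc by (cases "r' = m") (simp_all add: binomial_eq_0 pochhammer_Suc algebra_simps)
    qed
  qed
  finally show ?case by (simp add: I_def c_def \<gamma>_def)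
qed

section \<open>The law of the conditioned Gibbs partition\<close>

text \<open>Passes from indices i to blocks of \<open>Q\<close>, the language of
  \<open>joins_old_of_size\<close>. Injectivity of \<open>A\<close> ensures that each block is
  counted once.\<close>

lemma old_blocks_of_size_conv_card:
  assumes Q: "Q \<in> extensions n m (A ` {1..j})" and P: "partition_on {1..n} (A ` {1..j})"
    and inj: "inj_on A {1..j}"
  shows "old_blocks_of_size n m A j l Q = card {B \<in> Q. B \<inter> {1..n} \<noteq> {} \<and> card B = l}"
proof -
  have fin: "finite Q" using finite_elements[OF _ extensionsD(1)[OF Q]] by simp
  have "old_blocks_of_size n m A j l Q = (\<Sum>i=1..j. of_bool (card (old_block Q (A i)) = l))"
    unfolding old_blocks_of_size_def
    by (intro sum.cong refl) (simp add: card_old_block[where A = A, OF Q P])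
  also have "\<dots> = (\<Sum>a\<in>A ` {1..j}. of_bool (card (old_block Q a) = l))"
    unfolding sum.reindex[OF inj] o_def ..
  also have "\<dots> = (\<Sum>B\<in>{B \<in> Q. B \<inter> {1..n} \<noteq> {}}. of_bool (card B = l))"
    by (rule sum.reindex_bij_betw[OF bij_betw_old_block[OF Q P]])
  also have "\<dots> = card {B \<in> Q. B \<inter> {1..n} \<noteq> {} \<and> card B = l}"
    using fin by (simp add: Int_def conj_assoc)
  finally show ?thesis .
qed

section \<open>Statistics and events determined by finite restrictions\<close>

lemma bex_restrict_partition:
  "(\<exists>B\<in>restrict_partition N P. \<phi> B) \<longleftrightarrow> (\<exists>B\<in>P. B \<inter> {1..N} \<noteq> {} \<and> \<phi> (B \<inter> {1..N}))"
  unfolding restrict_partition_def by blast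

lemma old_block_gain_restrict_partition:
  assumes "A i \<subseteq> {1..n}"
  shows "old_block_gain n m A i (restrict_partition (n + m) P) = old_block_gain n m A i P"
proof -
  have sub: "A i \<subseteq> B \<inter> {1..n + m} \<longleftrightarrow> A i \<subseteq> B" for B using assms by auto
  have "(\<exists>B\<in>restrict_partition (n + m) P. A i \<subseteq> B \<and> x \<in> B) \<longleftrightarrow> (\<exists>B\<in>P. A i \<subseteq> B \<and> x \<in> B)"
    if "x \<in> {n + 1..n + m}" for x
    unfolding bex_restrict_partition sub by (rule bex_cong[OF refl]) (use that in auto)
  then show ?thesis
    unfolding old_block_gain_def by (intro arg_cong[where f = card] Collect_cong conj_cong refl)
qed

lemma P_old_restrict_partition:
  assumes "\<And>i. i \<in> {1..j} \<Longrightarrow> A i \<subseteq> {1..n}"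
  shows "P_old \<alpha> V n m A j l (restrict_partition (n + m) P) = P_old \<alpha> V n m A j l P"
proof -
  have "old_blocks_of_size n m A j l (restrict_partition (n + m) P) = old_blocks_of_size n m A j l P"
    unfolding old_blocks_of_size_def
    by (intro sum.cong refl) (simp only: old_block_gain_restrict_partition[where A = A, OF assms])
  moreover have "new_blocks n m (restrict_partition (n + m) P) = new_blocks n m P"
    by (simp add: new_blocks_def restrict_restrict_partition)
  ultimately show ?thesis by (simp add: P_old_def)
qed

lemma joins_old_of_size_restrict_partition:
  "joins_old_of_size n m l (restrict_partition (Suc (n + m)) P) = joins_old_of_size n m l P"
proof -
  let ?T = "{1..Suc (n + m)}"
  have *: "n + m + 1 \<in> B \<inter> ?T \<longleftrightarrow> n + m + 1 \<in> B" "B \<inter> ?T \<inter> {1..n} = B \<inter> {1..n}"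
    "B \<inter> ?T \<inter> {1..n + m} = B \<inter> {1..n + m}" for B
    by auto
  show ?thesis
    unfolding joins_old_of_size_def bex_restrict_partition *
    by (rule bex_cong[OF refl]) auto
qed

text \<open>Only the enlarged block contains n + m + 1, so the event is a condition on
  \<open>X\<close>; a newly opened block fails it because \<open>{}\<close> does not meet
  {1..n}.\<close>

lemma joins_old_of_size_add_to_block:
  assumes Q: "partition_on {1..n + m} Q" and X: "X \<in> insert {} Q"
  shows "joins_old_of_size n m l (add_to_block (n + m) Q X) \<longleftrightarrow> X \<inter> {1..n} \<noteq> {} \<and> card X = l"
proof -
  have "n + m + 1 \<in> B \<longleftrightarrow> B = insert (Suc (n + m)) X" if "B \<in> add_to_block (n + m) Q X" for B
    using that partition_blocks(3)[OF Q] by (auto simp: add_to_block_def)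
  then have "joins_old_of_size n m l (add_to_block (n + m) Q X) \<longleftrightarrow>
      insert (Suc (n + m)) X \<inter> {1..n} \<noteq> {} \<and> card (insert (Suc (n + m)) X \<inter> {1..n + m}) = l"
    unfolding joins_old_of_size_def by (auto simp: add_to_block_def)
  moreover have "insert (Suc (n + m)) X \<inter> {1..n} = X \<inter> {1..n}" by auto
  moreover have "insert (Suc (n + m)) X \<inter> {1..n + m} = X"
    using X partition_blocks(2)[OF Q, of X] by auto
  ultimately show ?thesis by simp
qed

lemma gibbs_partitionD:
  assumes "gibbs_partition M \<alpha> V \<rho>"
  shows "prob_space M" "\<alpha> < 1" "gibbs_weights \<alpha> V"
    and "\<omega> \<in> space M \<Longrightarrow> partition_on {1..} (\<rho> \<omega>)"
    and "{\<omega> \<in> space M. restrict_partition n (\<rho> \<omega>) = P} \<in> sets M"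
    and "1 \<le> n \<Longrightarrow> partition_on {1..n} P \<Longrightarrow>
      measure M {\<omega> \<in> space M. restrict_partition n (\<rho> \<omega>) = P} = V n (card P) * block_weight \<alpha> P"
  using assms unfolding gibbs_partition_def block_weight_def by simp_all

lemma restrict_partition_sample:
  assumes "gibbs_partition M \<alpha> V \<rho>" "\<omega> \<in> space M"
  shows "partition_on {1..N} (restrict_partition N (\<rho> \<omega>))"
  by (rule partition_on_restrict_partition[OF gibbs_partitionD(4)[OF assms]]) auto

text \<open>The event is a finite disjoint union of events fixing the restriction to {1..n + m},
  whose probabilities are prescribed.\<close>

lemma measure_restrict_partition:
  assumes gibbs: "gibbs_partition M \<alpha> V \<rho>" and n: "1 \<le> n"
  shows "measure M {\<omega> \<in> space M. \<phi> (restrict_partition (n + m) (\<rho> \<omega>)) \<and> restrict_partition n (\<rho> \<omega>) = P} =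
     (\<Sum>Q\<in>extensions n m P. of_bool (\<phi> Q) * (V (n + m) (card Q) * block_weight \<alpha> Q))"
proof -
  interpret prob_space M by (rule gibbs_partitionD(1)[OF gibbs])
  let ?E = "\<lambda>Q. {\<omega> \<in> space M. restrict_partition (n + m) (\<rho> \<omega>) = Q}"
  let ?S = "{Q \<in> extensions n m P. \<phi> Q}"
  have fin: "finite ?S" using finite_extensions by simp
  have "restrict_partition (n + m) (\<rho> \<omega>) \<in> extensions n m P \<longleftrightarrow> restrict_partition n (\<rho> \<omega>) = P"
    if "\<omega> \<in> space M" for \<omega>
    using restrict_partition_sample[OF gibbs that, of "n + m"]
    by (simp add: extensions_def restrict_restrict_partition)
  then have "{\<omega> \<in> space M. \<phi> (restrict_partition (n + m) (\<rho> \<omega>)) \<and> restrict_partition n (\<rho> \<omega>) = P} =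
      (\<Union>Q\<in>?S. ?E Q)"
    by auto
  also have "measure M \<dots> = (\<Sum>Q\<in>?S. measure M (?E Q))"
    by (rule finite_measure_finite_Union[OF fin])
      (use gibbs_partitionD(5)[OF gibbs] in \<open>auto simp: disjoint_family_on_def\<close>)
  also have "\<dots> = (\<Sum>Q\<in>?S. V (n + m) (card Q) * block_weight \<alpha> Q)"
    by (intro sum.cong refl gibbs_partitionD(6)[OF gibbs]) (use n in \<open>auto simp: extensions_def\<close>)
  also have "\<dots> = (\<Sum>Q\<in>extensions n m P. of_bool (\<phi> Q) * (V (n + m) (card Q) * block_weight \<alpha> Q))"
    by (rule sum.mono_neutral_cong_left) (auto simp: finite_extensions)
  finally show ?thesis .
qed

text \<open>The previous sum is used with n + m as the base and one added integer. Each old block of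
  size l contributes the factor l - \<alpha>; joining a block keeps the number of blocks, hence
  \<open>V (n + m + 1) (card R)\<close>.\<close>

lemma measure_joins_old_of_size:
  assumes gibbs: "gibbs_partition M \<alpha> V \<rho>" and n: "1 \<le> n"
    and P: "partition_on {1..n} (A ` {1..j})" and inj: "inj_on A {1..j}"
    and R: "R \<in> extensions n m (A ` {1..j})"
  shows "measure M {\<omega> \<in> space M. joins_old_of_size n m l (\<rho> \<omega>) \<and> restrict_partition (n + m) (\<rho> \<omega>) = R} =
     V (n + m + 1) (card R) * (real l - \<alpha>) * real (old_blocks_of_size n m A j l R) * block_weight \<alpha> R"
proof -
  note Rp = extensionsD(1)[OF R]
  have fin: "finite R" using finite_elements[OF _ Rp] by simp
  let ?c = "V (n + m + 1) (card R) * block_weight \<alpha> R"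
  let ?g = "\<lambda>S. of_bool (joins_old_of_size n m l S) * (V (n + m + 1) (card S) * block_weight \<alpha> S)"
  have "measure M {\<omega> \<in> space M. joins_old_of_size n m l (\<rho> \<omega>) \<and> restrict_partition (n + m) (\<rho> \<omega>) = R} =
      (\<Sum>S\<in>extensions (n + m) (Suc 0) R. ?g S)"
    using measure_restrict_partition[OF gibbs, of "n + m" "joins_old_of_size n m l" "Suc 0" R] n
    by (simp add: joins_old_of_size_restrict_partition)
  also have "\<dots> = (\<Sum>B\<in>R. ?g (add_to_block (n + m) R B))"
    unfolding sum_extensions_Suc_0[OF Rp] by (simp add: joins_old_of_size_add_to_block[OF Rp])
  also have "\<dots> = (\<Sum>B\<in>R. of_bool (B \<inter> {1..n} \<noteq> {} \<and> card B = l) * (?c * (real l - \<alpha>)))"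
    by (intro sum.cong refl) (auto simp: joins_old_of_size_add_to_block[OF Rp]
        card_add_to_block(2)[OF Rp] block_weight_add_to_block(2)[OF Rp])
  also have "\<dots> = real (old_blocks_of_size n m A j l R) * (?c * (real l - \<alpha>))"
    unfolding old_blocks_of_size_conv_card[OF R P inj] sum_distrib_right[symmetric]
    using fin by (simp add: Int_def)
  finally show ?thesis by (simp only: mult_ac)
qed

text \<open>Since k\<alpha> < k \<le> N, the recursion writes \<open>V N k\<close> as a sum of
  nonnegative terms with a positive coefficient at \<open>V (N + 1) k\<close>.\<close>

lemma gibbs_weights_eq_0:
  assumes V: "gibbs_weights \<alpha> V" and \<alpha>: "\<alpha> < 1" and k: "1 \<le> k" "k \<le> N" and 0: "V N k = 0"
  shows "V (N + 1) k = 0"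
proof -
  have V': "0 \<le> V n k \<and> V n k = (real n - real k * \<alpha>) * V (n + 1) k + V (n + 1) (k + 1)"
    if "1 \<le> k" "k \<le> n" for n k
    using V that unfolding gibbs_weights_def by blast
  have rec: "V N k = (real N - real k * \<alpha>) * V (N + 1) k + V (N + 1) (k + 1)"
    using V'[OF k] by (rule conjunct2)
  have nonneg: "0 \<le> V (N + 1) k" "0 \<le> V (N + 1) (k + 1)"
    using k by (auto intro!: conjunct1[OF V'])
  have "real k * \<alpha> < real k" using k \<alpha> by simp
  also have "\<dots> \<le> real N" using k by simp
  finally have pos: "0 < real N - real k * \<alpha>" by simp
  then have "0 \<le> (real N - real k * \<alpha>) * V (N + 1) k" using nonneg by simp
  then have "(real N - real k * \<alpha>) * V (N + 1) k = 0" using rec 0 nonneg by linarith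
  with pos show ?thesis by simp
qed

text \<open>
  If \<open>V (n + m) (card R) = 0\<close>, both sides are \<open>0\<close> by the convention \<open>x / 0 = 0\<close>.
\<close>

lemma cond_prob_joins_old_of_size:
  assumes gibbs: "gibbs_partition M \<alpha> V \<rho>" and n: "1 \<le> n"
    and P: "partition_on {1..n} (A ` {1..j})" and inj: "inj_on A {1..j}"
    and R: "R \<in> extensions n m (A ` {1..j})"
  shows "\<P>(\<omega> in M. joins_old_of_size n m l (\<rho> \<omega>) \<bar> restrict_partition (n + m) (\<rho> \<omega>) = R) =
     P_old \<alpha> V n m A j l R"
proof -
  have "card R = j + new_blocks n m R"
    using card_extension[OF R P] card_image[OF inj] by simp
  moreover have "block_weight \<alpha> R \<noteq> 0"
    using block_weight_pos[OF gibbs_partitionD(2)[OF gibbs], of R] by simp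
  moreover have "measure M {\<omega> \<in> space M. restrict_partition (n + m) (\<rho> \<omega>) = R} =
      V (n + m) (card R) * block_weight \<alpha> R"
    by (rule gibbs_partitionD(6)[OF gibbs _ extensionsD(1)[OF R]]) (use n in simp)
  ultimately show ?thesis
    by (simp add: cond_prob_def measure_joins_old_of_size[OF gibbs n P inj R] P_old_def)
qed

text \<open>The integrand takes finitely many values, so it is a combination of indicators. Their
  conditional probabilities are quotients of Gibbs probabilities for extensions of \<open>P\<close>,
  and 0 for all other partitions.\<close>

lemma integral_given_partition:
  fixes f :: "nat set set \<Rightarrow> real"
  assumes gibbs: "gibbs_partition M \<alpha> V \<rho>" and n: "1 \<le> n"
    and P: "partition_on {1..n} P" and V_pos: "0 < V n (card P)"
  shows "(\<integral>\<omega>. f (restrict_partition (n + m) (\<rho> \<omega>)) \<partial>given_partition M \<rho> n P) =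
     (\<Sum>Q\<in>extensions n m P. f Q * (V (n + m) (card Q) * block_weight \<alpha> Q)) /
       (V n (card P) * block_weight \<alpha> P)"
proof -
  interpret prob_space M by (rule gibbs_partitionD(1)[OF gibbs])
  let ?E = "{\<omega> \<in> space M. restrict_partition n (\<rho> \<omega>) = P}"
  let ?D = "given_partition M \<rho> n P"
  let ?F = "\<lambda>Q. {\<omega> \<in> space M. restrict_partition (n + m) (\<rho> \<omega>) = Q}"
  let ?T = "{Q. partition_on {1..n + m} Q}"
  have finT: "finite ?T" by (rule finitely_many_partition_on) simp
  have E: "measure M ?E = V n (card P) * block_weight \<alpha> P"
    by (rule gibbs_partitionD(6)[OF gibbs n P])
  have "0 < measure M ?E"
    unfolding E using V_pos block_weight_pos[OF gibbs_partitionD(2)[OF gibbs]] by simp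
  then have E0: "emeasure M ?E \<noteq> 0" "emeasure M ?E \<noteq> \<infinity>"
    by (auto simp: measure_def)
  then interpret D: prob_space ?D
    unfolding given_partition_def by (rule prob_space_uniform_measure)
  have space_D: "space ?D = space M" and sets_D: "sets ?D = sets M"
    by (simp_all add: given_partition_def)
  have F: "?F Q \<in> sets M" for Q by (rule gibbs_partitionD(5)[OF gibbs])
  have "(\<integral>\<omega>. f (restrict_partition (n + m) (\<rho> \<omega>)) \<partial>?D) =
      (\<integral>\<omega>. (\<Sum>Q\<in>?T. f Q * indicator (?F Q) \<omega>) \<partial>?D)"
  proof (rule Bochner_Integration.integral_cong[OF refl])
    fix \<omega> assume "\<omega> \<in> space ?D"
    then have \<omega>: "\<omega> \<in> space M" by (simp add: space_D)
    have "(\<Sum>Q\<in>?T. f Q * indicator (?F Q) \<omega>) =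
        (\<Sum>Q\<in>?T. if Q = restrict_partition (n + m) (\<rho> \<omega>) then f Q else 0)"
      by (intro sum.cong refl) (use \<omega> in auto)
    then show "f (restrict_partition (n + m) (\<rho> \<omega>)) = (\<Sum>Q\<in>?T. f Q * indicator (?F Q) \<omega>)"
      using finT restrict_partition_sample[OF gibbs \<omega>] by simp
  qed
  also have "\<dots> = (\<Sum>Q\<in>?T. \<integral>\<omega>. f Q * indicator (?F Q) \<omega> \<partial>?D)"
    by (rule Bochner_Integration.integral_sum, rule integrable_mult_right, rule integrable_real_indicator)
      (simp_all add: sets_D F D.emeasure_eq_measure)
  also have "\<dots> = (\<Sum>Q\<in>?T. f Q * measure ?D (?F Q))"
    using F by (simp add: sets_D space_D)
  also have "\<dots> = (\<Sum>Q\<in>extensions n m P. f Q * (V (n + m) (card Q) * block_weight \<alpha> Q /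
      (V n (card P) * block_weight \<alpha> P)))"
  proof (rule sum.mono_neutral_cong_right[OF finT])
    show "extensions n m P \<subseteq> ?T" by (auto simp: extensions_def)
    have D: "measure ?D (?F Q) = measure M (?E \<inter> ?F Q) / measure M ?E" for Q
      unfolding given_partition_def by (rule measure_uniform_measure[OF E0 F])
    have sub: "restrict_partition n Q = P" if "\<omega> \<in> ?E \<inter> ?F Q" for \<omega> Q
      using that restrict_restrict_partition[of n "n + m" "\<rho> \<omega>"] by auto
    show "\<forall>Q\<in>?T - extensions n m P. f Q * measure ?D (?F Q) = 0"
    proof
      fix Q assume "Q \<in> ?T - extensions n m P"
      then have "restrict_partition n Q \<noteq> P" by (auto simp: extensions_def)
      then have "?E \<inter> ?F Q = {}" using sub[of _ Q] by blast
      then show "f Q * measure ?D (?F Q) = 0" by (simp only: D) simp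
    qed
    fix Q assume Q: "Q \<in> extensions n m P"
    then have "?E \<inter> ?F Q = ?F Q"
      using restrict_restrict_partition[of n "n + m"] by (auto simp: extensions_def)
    then have "measure M (?E \<inter> ?F Q) = V (n + m) (card Q) * block_weight \<alpha> Q"
      using gibbs_partitionD(6)[OF gibbs _ extensionsD(1)[OF Q]] n by simp
    then show "f Q * measure ?D (?F Q) = f Q * (V (n + m) (card Q) * block_weight \<alpha> Q /
        (V n (card P) * block_weight \<alpha> P))"
      by (simp only: D E)
  qed
  finally show ?thesis by (simp add: sum_divide_distrib)
qed

text \<open>A final size l forces the gain l - c, which is impossible for c > l. Extensions are then
  sorted by the number k of new blocks, on which \<open>W\<close> depends; \<open>W\<close> will be
  \<open>V (n + m + 1)\<close>.\<close>

lemma sum_extensions_old_block_card: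
  fixes A :: "nat \<Rightarrow> nat set" and \<alpha> l
  assumes P: "partition_on {1..n} P" and a: "A i \<in> P" and \<alpha>: "\<alpha> < 1"
  defines "c \<equiv> card (A i)"
  shows "(\<Sum>Q\<in>extensions n m P. W (card Q) * block_weight \<alpha> Q *
        of_bool (c + old_block_gain n m A i Q = l)) =
     of_bool (c \<le> l) * block_weight \<alpha> P *
       (real (m choose (l - c)) * pochhammer (real c - \<alpha>) (l - c) *
       (\<Sum>k=0..m - (l - c). W (card P + k) *
          gstirling_nc \<alpha> (- (real n - real (card P) * \<alpha> - real c + \<alpha>)) (m - (l - c)) k))"
    (is "?lhs = of_bool _ * _ * (?b * ?p * ?s)")
proof (cases "c \<le> l")
  case True
  let ?I = "\<lambda>Q k. of_bool (old_block_gain n m A i Q = l - c \<and> new_blocks n m Q = k) :: real"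
  let ?T = "gstirling_nc \<alpha> (- (real n - real (card P) * \<alpha> - real c + \<alpha>)) (m - (l - c))"
  have "W (card Q) * block_weight \<alpha> Q * of_bool (c + old_block_gain n m A i Q = l) =
      (\<Sum>k=0..n + m. W (card P + k) * (block_weight \<alpha> Q * ?I Q k))" if Q: "Q \<in> extensions n m P" for Q
  proof -
    \<comment> \<open>The bound n + m is a crude range independent of \<open>Q\<close>; the
      vanishing of the Stirling numbers later cuts it to m - (l - c).\<close>
    have "new_blocks n m Q \<in> {0..n + m}"
      using card_extension[OF Q P] card_partition_le[OF extensionsD(1)[OF Q]] by simp
    then have "(\<Sum>k=0..n + m. W (card P + k) * (block_weight \<alpha> Q * ?I Q k)) =
        (\<Sum>k\<in>{new_blocks n m Q}. W (card P + k) * (block_weight \<alpha> Q * ?I Q k))"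
      by (intro sum.mono_neutral_right) auto
    also have "\<dots> = W (card Q) * block_weight \<alpha> Q * of_bool (c + old_block_gain n m A i Q = l)"
      using True by (auto simp: card_extension[OF Q P])
    finally show ?thesis ..
  qed
  then have "?lhs = (\<Sum>Q\<in>extensions n m P. \<Sum>k=0..n + m. W (card P + k) * (block_weight \<alpha> Q * ?I Q k))"
    by (rule sum.cong[OF refl])
  also have "\<dots> = (\<Sum>k=0..n + m. W (card P + k) * (\<Sum>Q\<in>extensions n m P. block_weight \<alpha> Q * ?I Q k))"
    unfolding sum_distrib_left by (rule sum.swap)
  also have "\<dots> = (\<Sum>k=0..n + m. W (card P + k) * (block_weight \<alpha> P * (?b * ?p * ?T k)))"
    unfolding sum_block_weight_class[where A = A, OF P a] c_def ..
  also have "\<dots> = block_weight \<alpha> P * (?b * ?p * (\<Sum>k=0..n + m. W (card P + k) * ?T k))"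
    by (simp add: sum_distrib_left mult_ac)
  also have "(\<Sum>k=0..n + m. W (card P + k) * ?T k) = ?s"
    by (rule sum.mono_neutral_right) (auto simp: gstirling_nc_eq_0)
  finally show ?thesis using True by simp
qed (auto intro!: sum.neutral)

text \<open>
  If \<open>V (n + m) (card Q)\<close> vanishes, so does \<open>V (n + m + 1) (card Q)\<close>, hence the factors
  \<open>V (n + m) (card Q)\<close> cancel in every case.
\<close>

lemma P_old_times_weight:
  assumes V: "gibbs_weights \<alpha> V" and \<alpha>: "\<alpha> < 1" and n: "1 \<le> n"
    and P: "partition_on {1..n} (A ` {1..j})" and inj: "inj_on A {1..j}"
    and Q: "Q \<in> extensions n m (A ` {1..j})"
  shows "P_old \<alpha> V n m A j l Q * (V (n + m) (card Q) * block_weight \<alpha> Q) =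
     (real l - \<alpha>) * (\<Sum>i=1..j. V (n + m + 1) (card Q) * block_weight \<alpha> Q *
       of_bool (card (A i) + old_block_gain n m A i Q = l))"
proof -
  have card_Q: "card Q = j + new_blocks n m Q"
    using card_extension[OF Q P] card_image[OF inj] by simp
  have "A ` {1..j} \<noteq> {}" using partition_onD1[OF P] n by auto
  then have "1 \<le> card Q" by (auto simp: card_Q)
  then have "V (n + m + 1) (card Q) = 0" if "V (n + m) (card Q) = 0"
    using gibbs_weights_eq_0[OF V \<alpha> _ card_partition_le[OF extensionsD(1)[OF Q]]] that by blast
  then have "V (n + m + 1) (card Q) / V (n + m) (card Q) * V (n + m) (card Q) = V (n + m + 1) (card Q)"
    by (cases "V (n + m) (card Q) = 0") simp_all
  moreover have "P_old \<alpha> V n m A j l Q * (V (n + m) (card Q) * block_weight \<alpha> Q) =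
      V (n + m + 1) (card Q) / V (n + m) (card Q) * V (n + m) (card Q) *
      ((real l - \<alpha>) * real (old_blocks_of_size n m A j l Q) * block_weight \<alpha> Q)"
    unfolding P_old_def card_Q[symmetric] by (simp only: mult_ac)
  ultimately show ?thesis
    unfolding sum_distrib_left[symmetric] old_blocks_of_size_def
    by (simp only: mult_ac of_nat_sum of_nat_of_bool)
qed

text \<open>Indices are grouped by block size, which turns the sum over old blocks into one with the
  multiplicities m_\<xi>.\<close>

lemma sum_blocks_of_size:
  fixes h :: "nat \<Rightarrow> real"
  assumes "\<And>i. i \<in> {1..j} \<Longrightarrow> 1 \<le> card (A i)"
  shows "(\<Sum>i=1..j. of_bool (card (A i) \<le> l) * h (card (A i))) =
     (\<Sum>\<xi>=1..l. real (blocks_of_size A j \<xi>) * h \<xi>)"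
proof -
  have "of_bool (card (A i) \<le> l) * h (card (A i)) = (\<Sum>\<xi>=1..l. of_bool (card (A i) = \<xi>) * h \<xi>)"
    if "i \<in> {1..j}" for i
  proof -
    have "(\<Sum>\<xi>=1..l. of_bool (card (A i) = \<xi>) * h \<xi>) =
        (\<Sum>\<xi>=1..l. if card (A i) = \<xi> then h \<xi> else 0)"
      by (intro sum.cong refl) simp
    then show ?thesis using assms[OF that] by simp
  qed
  then have "(\<Sum>i=1..j. of_bool (card (A i) \<le> l) * h (card (A i))) =
      (\<Sum>i=1..j. \<Sum>\<xi>=1..l. of_bool (card (A i) = \<xi>) * h \<xi>)"
    by (rule sum.cong[OF refl])
  also have "\<dots> = (\<Sum>\<xi>=1..l. (\<Sum>i=1..j. of_bool (card (A i) = \<xi>)) * h \<xi>)"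
    unfolding sum_distrib_right by (rule sum.swap)
  finally show ?thesis by (simp add: blocks_of_size_def Int_def)
qed

text \<open>The first conjunct justifies \<open>P_old\<close> as a conditional probability given the
  partition of {1..n + m}; the second evaluates its estimator. When l - \<xi> > m, the truncated
  index m - (l - \<xi>) is harmless because the binomial coefficient is 0.\<close>

theorem proposition13:
  fixes M :: "'a measure" and \<rho> :: "'a \<Rightarrow> nat set set"
    and \<alpha> :: real and V :: "nat \<Rightarrow> nat \<Rightarrow> real"
    and n m j l :: nat and A :: "nat \<Rightarrow> nat set"
  assumes gibbs: "gibbs_partition M \<alpha> V \<rho>"
    and n: "1 \<le> n" and m: "1 \<le> m"
    and partition: "partition_on {1..n} (A ` {1..j})" and inj: "inj_on A {1..j}"
    and V_pos: "0 < V n j"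
    and l: "l \<in> {1..n + m}"
  shows "(AE \<omega> in given_partition M \<rho> n (A ` {1..j}).
            \<P>(\<omega>' in M. joins_old_of_size n m l (\<rho> \<omega>') \<bar>
               restrict_partition (n + m) (\<rho> \<omega>') = restrict_partition (n + m) (\<rho> \<omega>))
            = P_old \<alpha> V n m A j l (\<rho> \<omega>))
       \<and> bayes_estimator M \<rho> n (A ` {1..j}) (\<lambda>\<omega>. P_old \<alpha> V n m A j l (\<rho> \<omega>))
         = (real l - \<alpha>) * (\<Sum>\<xi>=1..l. real (blocks_of_size A j \<xi>) * real (m choose (l - \<xi>)) *
             pochhammer (real \<xi> - \<alpha>) (l - \<xi>) *
             (\<Sum>k=0..m - (l - \<xi>). V (n + m + 1) (j + k) / V n j *
                gstirling_nc \<alpha> (- (real n - real j * \<alpha> - real \<xi> + \<alpha>)) (m - (l - \<xi>)) k))"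
proof
  let ?P = "A ` {1..j}"
  note \<alpha> = gibbs_partitionD(2)[OF gibbs]
  have card_P: "card ?P = j" using card_image[OF inj] by simp
  have sub: "A i \<subseteq> {1..n}" if "i \<in> {1..j}" for i
    using partition_blocks(2)[OF partition, of "A i"] that by blast
  show "AE \<omega> in given_partition M \<rho> n ?P.
      \<P>(\<omega>' in M. joins_old_of_size n m l (\<rho> \<omega>') \<bar>
         restrict_partition (n + m) (\<rho> \<omega>') = restrict_partition (n + m) (\<rho> \<omega>))
      = P_old \<alpha> V n m A j l (\<rho> \<omega>)"
    unfolding given_partition_def
  proof (rule AE_uniform_measureI[OF gibbs_partitionD(5)[OF gibbs]], rule AE_I2, rule impI)
    fix \<omega> assume \<omega>: "\<omega> \<in> space M"
      and "\<omega> \<in> {\<omega> \<in> space M. restrict_partition n (\<rho> \<omega>) = ?P}"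
    then have "restrict_partition (n + m) (\<rho> \<omega>) \<in> extensions n m ?P"
      using restrict_partition_sample[OF gibbs \<omega>, of "n + m"]
      by (simp add: extensions_def restrict_restrict_partition)
    from cond_prob_joins_old_of_size[OF gibbs n partition inj this]
    show "\<P>(\<omega>' in M. joins_old_of_size n m l (\<rho> \<omega>') \<bar>
         restrict_partition (n + m) (\<rho> \<omega>') = restrict_partition (n + m) (\<rho> \<omega>))
      = P_old \<alpha> V n m A j l (\<rho> \<omega>)"
      by (simp only: P_old_restrict_partition[where A = A, OF sub])
  qed
  \<comment> \<open>Up to the weight of the observed partition, l - \<alpha> and division by
    \<open>V n j\<close>, this is the contribution of one old block of size \<xi>.\<close>
  define h where "h \<xi> = real (m choose (l - \<xi>)) * pochhammer (real \<xi> - \<alpha>) (l - \<xi>) *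
      (\<Sum>k=0..m - (l - \<xi>). V (n + m + 1) (j + k) *
        gstirling_nc \<alpha> (- (real n - real j * \<alpha> - real \<xi> + \<alpha>)) (m - (l - \<xi>)) k)" for \<xi>
  have h_div: "h \<xi> / V n j = real (m choose (l - \<xi>)) * pochhammer (real \<xi> - \<alpha>) (l - \<xi>) *
      (\<Sum>k=0..m - (l - \<xi>). V (n + m + 1) (j + k) / V n j *
        gstirling_nc \<alpha> (- (real n - real j * \<alpha> - real \<xi> + \<alpha>)) (m - (l - \<xi>)) k)" for \<xi>
    by (simp add: h_def flip: sum_divide_distrib)
  let ?w = "block_weight \<alpha> ?P"
  have "bayes_estimator M \<rho> n ?P (\<lambda>\<omega>. P_old \<alpha> V n m A j l (\<rho> \<omega>)) =
      (\<integral>\<omega>. P_old \<alpha> V n m A j l (restrict_partition (n + m) (\<rho> \<omega>)) \<partial>given_partition M \<rho> n ?P)"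
    by (simp only: bayes_estimator_def P_old_restrict_partition[where A = A, OF sub])
  also have "\<dots> = (\<Sum>Q\<in>extensions n m ?P. P_old \<alpha> V n m A j l Q * (V (n + m) (card Q) * block_weight \<alpha> Q)) /
      (V n j * ?w)"
    using integral_given_partition[OF gibbs n partition, of "P_old \<alpha> V n m A j l" m] V_pos
    unfolding card_P by simp
  also have "(\<Sum>Q\<in>extensions n m ?P. P_old \<alpha> V n m A j l Q * (V (n + m) (card Q) * block_weight \<alpha> Q)) =
      (real l - \<alpha>) * (\<Sum>Q\<in>extensions n m ?P. \<Sum>i=1..j. V (n + m + 1) (card Q) * block_weight \<alpha> Q *
        of_bool (card (A i) + old_block_gain n m A i Q = l))"
    unfolding sum_distrib_left[of "real l - \<alpha>"]
    by (intro sum.cong refl)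
      (simp only: P_old_times_weight[OF gibbs_partitionD(3)[OF gibbs] \<alpha> n partition inj] sum_distrib_left)
  also have "(\<Sum>Q\<in>extensions n m ?P. \<Sum>i=1..j. V (n + m + 1) (card Q) * block_weight \<alpha> Q *
        of_bool (card (A i) + old_block_gain n m A i Q = l)) =
      (\<Sum>i=1..j. \<Sum>Q\<in>extensions n m ?P. V (n + m + 1) (card Q) * block_weight \<alpha> Q *
        of_bool (card (A i) + old_block_gain n m A i Q = l))"
    by (rule sum.swap)
  also have "\<dots> = (\<Sum>i=1..j. ?w * (of_bool (card (A i) \<le> l) * h (card (A i))))"
  proof (rule sum.cong[OF refl])
    fix i assume "i \<in> {1..j}"
    then have "A i \<in> ?P" by blast
    from sum_extensions_old_block_card[where A = A and W = "V (n + m + 1)", OF partition this \<alpha>, of m l]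
    show "(\<Sum>Q\<in>extensions n m ?P. V (n + m + 1) (card Q) * block_weight \<alpha> Q *
        of_bool (card (A i) + old_block_gain n m A i Q = l)) =
        ?w * (of_bool (card (A i) \<le> l) * h (card (A i)))"
      unfolding h_def card_P by (simp only: mult_ac)
  qed
  also have "\<dots> = ?w * (\<Sum>\<xi>=1..l. real (blocks_of_size A j \<xi>) * h \<xi>)"
    unfolding sum_distrib_left[of ?w, symmetric]
    by (subst sum_blocks_of_size) (use partition_blocks(5)[OF partition] in \<open>simp_all add: Suc_le_eq\<close>)
  also have "(real l - \<alpha>) * (?w * (\<Sum>\<xi>=1..l. real (blocks_of_size A j \<xi>) * h \<xi>)) / (V n j * ?w) = (real l - \<alpha>) * (\<Sum>\<xi>=1..l. real (blocks_of_size A j \<xi>) * (h \<xi> / V n j))"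
    using block_weight_pos[OF \<alpha>, of ?P]
    by (simp add: sum_divide_distrib[symmetric])
  finally show "bayes_estimator M \<rho> n ?P (\<lambda>\<omega>. P_old \<alpha> V n m A j l (\<rho> \<omega>))
      = (real l - \<alpha>) * (\<Sum>\<xi>=1..l. real (blocks_of_size A j \<xi>) * real (m choose (l - \<xi>)) *
           pochhammer (real \<xi> - \<alpha>) (l - \<xi>) *
           (\<Sum>k=0..m - (l - \<xi>). V (n + m + 1) (j + k) / V n j *
              gstirling_nc \<alpha> (- (real n - real j * \<alpha> - real \<xi> + \<alpha>)) (m - (l - \<xi>)) k))"
    by (simp only: h_div mult.assoc)
qed

end
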